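(* Let $\mathrm{pa17}$ be the sentence $\forall x\,\forall y\,\bigl(y\ne0\rightarrow\exists q\,\exists r\,(r<y\land x=q\cdot y+r)\bigr)$. Then $$\mathrm{PA}_{\mathrm{smu}}^{-}\cup\operatorname{Th}_{\forall}(\mathfrak N_0)\nvdash\mathrm{pa17}.$$ In particular, $\mathrm{PA}_{\mathrm{smu}}^{-}\nvdash\mathrm{pa17}$.
   Context: The base language is $\mathcal L_0=\{0,1,+,\cdot,\le\}$ (first-order logic with equality). Abbreviations: $2:=1+1$; $x<y$ means $x\le y\land x\ne y$; $x\mid y$ means $\exists z\,(z\cdot x=y)$; $\operatorname{pow}_2(x)$ means $\forall y\,(y\mid x\rightarrow(y=1\lor 2\mid y))$. $\mathrm{PA}_{\mathrm{smu}}^{-}$ is the $\mathcal L_0$-theory whose axioms are the universal closures of: (pa1) $x+0=x$; (pa2) $x+y=y+x$; (pa3) $(x+y)+z=x+(y+z)$; (pa4) $x\cdot1=x$; (pa5) $x\cdot y=y\cdot x$; (pa6) $(x\cdot y)\cdot z=x\cdot(y\cdot z)$; (pa7) $x\cdot(y+z)=x\cdot y+x\cdot z$; (pa8) $x\le y\lor y\le x$; (pa9) $(x\le y\land y\le z)\rightarrow x\le z$; (pa10) $\neg(x+1\le x)$; (pa11) $y\le x\rightarrow(y=x\lor y+1\le x)$; (pa12) $y\le x\rightarrow y+z\le x+z$; (pa13) $y\le x\rightarrow y\cdot z\le x\cdot z$; (pa15) $y\le x\rightarrow\exists z\,(x=y+z)$; (pa19) $\exists u\,(\operatorname{pow}_2(u)\land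 u\le x+1\land x+1<2\cdot u)$; (pa20) $(\operatorname{pow}_2(x)\land\operatorname{pow}_2(y)\land x\le y)\rightarrow x\mid y$. $\mathfrak N_0=(\mathbb N;0,1,+,\cdot,\le)$ is the standard model ($0\in\mathbb N$). $\operatorname{Th}_{\forall}(\mathfrak N_0)$ is the set of all universal $\mathcal L_0$-sentences (a block of universal quantifiers followed by a quantifier-free formula) true in $\mathfrak N_0$. $\vdash$ is provability in first-order logic with equality. *)

theory Defs
  imports Main
begin

section \<open>First-order logic with equality over \<open>0, 1, +, \<cdot>, \<le>\<close>\<close>

text \<open>Variables are de Bruijn indices: under a quantifier, \<open>Var 0\<close> is the variable bound
  by the innermost quantifier. \<open>Var i\<close> with \<open>i\<close> at least the number of enclosing
  quantifiers is free.\<close>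

datatype tm =
    Var nat
  | Zero ("\<^bold>0")
  | One ("\<^bold>1")
  | Add tm tm (infixl "\<^bold>+" 85)
  | Mul tm tm (infixl "\<^bold>*" 90)

datatype fm =
    Falsum ("\<^bold>\<bottom>")
  | Eq tm tm (infix "\<^bold>=" 75)
  | Le tm tm (infix "\<^bold>\<le>" 75)
  | Imp fm fm (infixr "\<^bold>\<longrightarrow>" 55)
  | Con fm fm (infixr "\<^bold>\<and>" 65)
  | Dis fm fm (infixr "\<^bold>\<or>" 60)
  | Forall fm ("\<^bold>\<forall> _" [70] 70)
  | Exists fm ("\<^bold>\<exists> _" [70] 70)

abbreviation Neg :: "fm \<Rightarrow> fm" ("\<^bold>\<not> _" [70] 70) where
  "\<^bold>\<not> p \<equiv> p \<^bold>\<longrightarrow> \<^bold>\<bottom>"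

subsection \<open>Substitution\<close>

primrec subst_tm :: "(nat \<Rightarrow> tm) \<Rightarrow> tm \<Rightarrow> tm" where
  "subst_tm \<sigma> (Var i) = \<sigma> i"
| "subst_tm \<sigma> \<^bold>0 = \<^bold>0"
| "subst_tm \<sigma> \<^bold>1 = \<^bold>1"
| "subst_tm \<sigma> (s \<^bold>+ t) = subst_tm \<sigma> s \<^bold>+ subst_tm \<sigma> t"
| "subst_tm \<sigma> (s \<^bold>* t) = subst_tm \<sigma> s \<^bold>* subst_tm \<sigma> t"

definition lift_tm :: "tm \<Rightarrow> tm" where
  "lift_tm = subst_tm (\<lambda>i. Var (Suc i))"

definition under_binder :: "(nat \<Rightarrow> tm) \<Rightarrow> nat \<Rightarrow> tm" where
  "under_binder \<sigma> = case_nat (Var 0) (\<lambda>i. lift_tm (\<sigma> i))"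

primrec subst :: "(nat \<Rightarrow> tm) \<Rightarrow> fm \<Rightarrow> fm" where
  "subst \<sigma> \<^bold>\<bottom> = \<^bold>\<bottom>"
| "subst \<sigma> (s \<^bold>= t) = (subst_tm \<sigma> s \<^bold>= subst_tm \<sigma> t)"
| "subst \<sigma> (s \<^bold>\<le> t) = (subst_tm \<sigma> s \<^bold>\<le> subst_tm \<sigma> t)"
| "subst \<sigma> (p \<^bold>\<longrightarrow> q) = (subst \<sigma> p \<^bold>\<longrightarrow> subst \<sigma> q)"
| "subst \<sigma> (p \<^bold>\<and> q) = (subst \<sigma> p \<^bold>\<and> subst \<sigma> q)"
| "subst \<sigma> (p \<^bold>\<or> q) = (subst \<sigma> p \<^bold>\<or> subst \<sigma> q)"
| "subst \<sigma> (\<^bold>\<forall> p) = (\<^bold>\<forall> (subst (under_binder \<sigma>) p))"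
| "subst \<sigma> (\<^bold>\<exists> p) = (\<^bold>\<exists> (subst (under_binder \<sigma>) p))"

definition lift :: "fm \<Rightarrow> fm" where
  "lift = subst (\<lambda>i. Var (Suc i))"

text \<open>\<open>inst t p\<close> instantiates the variable with index \<open>0\<close> of the body \<open>p\<close> of a quantifier.\<close>

definition inst :: "tm \<Rightarrow> fm \<Rightarrow> fm" where
  "inst t = subst (case_nat t Var)"

subsection \<open>Provability\<close>

text \<open>Classical natural deduction. The contexts may be infinite; the eigenvariable conditions in
  \<open>AllI\<close> and \<open>ExE\<close> are expressed by lifting, which makes the index \<open>0\<close> fresh.\<close>

inductive provable :: "fm set \<Rightarrow> fm \<Rightarrow> bool" (infix "\<turnstile>" 50) where
  Assm: "p \<in> \<Gamma> \<Longrightarrow> \<Gamma> \<turnstile> p"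
| Classical: "insert (\<^bold>\<not> p) \<Gamma> \<turnstile> \<^bold>\<bottom> \<Longrightarrow> \<Gamma> \<turnstile> p"
| ImpI: "insert p \<Gamma> \<turnstile> q \<Longrightarrow> \<Gamma> \<turnstile> p \<^bold>\<longrightarrow> q"
| ImpE: "\<Gamma> \<turnstile> p \<^bold>\<longrightarrow> q \<Longrightarrow> \<Gamma> \<turnstile> p \<Longrightarrow> \<Gamma> \<turnstile> q"
| ConI: "\<Gamma> \<turnstile> p \<Longrightarrow> \<Gamma> \<turnstile> q \<Longrightarrow> \<Gamma> \<turnstile> p \<^bold>\<and> q"
| ConE1: "\<Gamma> \<turnstile> p \<^bold>\<and> q \<Longrightarrow> \<Gamma> \<turnstile> p"
| ConE2: "\<Gamma> \<turnstile> p \<^bold>\<and> q \<Longrightarrow> \<Gamma> \<turnstile> q"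
| DisI1: "\<Gamma> \<turnstile> p \<Longrightarrow> \<Gamma> \<turnstile> p \<^bold>\<or> q"
| DisI2: "\<Gamma> \<turnstile> q \<Longrightarrow> \<Gamma> \<turnstile> p \<^bold>\<or> q"
| DisE: "\<Gamma> \<turnstile> p \<^bold>\<or> q \<Longrightarrow> insert p \<Gamma> \<turnstile> r \<Longrightarrow> insert q \<Gamma> \<turnstile> r \<Longrightarrow> \<Gamma> \<turnstile> r"
| AllI: "lift ` \<Gamma> \<turnstile> p \<Longrightarrow> \<Gamma> \<turnstile> \<^bold>\<forall> p"
| AllE: "\<Gamma> \<turnstile> \<^bold>\<forall> p \<Longrightarrow> \<Gamma> \<turnstile> inst t p"
| ExI: "\<Gamma> \<turnstile> inst t p \<Longrightarrow> \<Gamma> \<turnstile> \<^bold>\<exists> p"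
| ExE: "\<Gamma> \<turnstile> \<^bold>\<exists> p \<Longrightarrow> insert p (lift ` \<Gamma>) \<turnstile> lift q \<Longrightarrow> \<Gamma> \<turnstile> q"
| EqRefl: "\<Gamma> \<turnstile> t \<^bold>= t"
| EqSubst: "\<Gamma> \<turnstile> s \<^bold>= t \<Longrightarrow> \<Gamma> \<turnstile> inst s p \<Longrightarrow> \<Gamma> \<turnstile> inst t p"

subsection \<open>Closed and universal formulas\<close>

text \<open>The least \<open>n\<close> such that all free variables have index less than \<open>n\<close>.\<close>

primrec fv_bound_tm :: "tm \<Rightarrow> nat" where
  "fv_bound_tm (Var i) = Suc i"
| "fv_bound_tm \<^bold>0 = 0"
| "fv_bound_tm \<^bold>1 = 0"
| "fv_bound_tm (s \<^bold>+ t) = max (fv_bound_tm s) (fv_bound_tm t)"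
| "fv_bound_tm (s \<^bold>* t) = max (fv_bound_tm s) (fv_bound_tm t)"

primrec fv_bound :: "fm \<Rightarrow> nat" where
  "fv_bound \<^bold>\<bottom> = 0"
| "fv_bound (s \<^bold>= t) = max (fv_bound_tm s) (fv_bound_tm t)"
| "fv_bound (s \<^bold>\<le> t) = max (fv_bound_tm s) (fv_bound_tm t)"
| "fv_bound (p \<^bold>\<longrightarrow> q) = max (fv_bound p) (fv_bound q)"
| "fv_bound (p \<^bold>\<and> q) = max (fv_bound p) (fv_bound q)"
| "fv_bound (p \<^bold>\<or> q) = max (fv_bound p) (fv_bound q)"
| "fv_bound (\<^bold>\<forall> p) = fv_bound p - 1"
| "fv_bound (\<^bold>\<exists> p) = fv_bound p - 1"

definition sentence :: "fm \<Rightarrow> bool" where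
  "sentence p \<longleftrightarrow> fv_bound p = 0"

definition univ_closure :: "fm \<Rightarrow> fm" where
  "univ_closure p = (Forall ^^ fv_bound p) p"

primrec quantifier_free :: "fm \<Rightarrow> bool" where
  "quantifier_free \<^bold>\<bottom> = True"
| "quantifier_free (s \<^bold>= t) = True"
| "quantifier_free (s \<^bold>\<le> t) = True"
| "quantifier_free (p \<^bold>\<longrightarrow> q) = (quantifier_free p \<and> quantifier_free q)"
| "quantifier_free (p \<^bold>\<and> q) = (quantifier_free p \<and> quantifier_free q)"
| "quantifier_free (p \<^bold>\<or> q) = (quantifier_free p \<and> quantifier_free q)"
| "quantifier_free (\<^bold>\<forall> p) = False"
| "quantifier_free (\<^bold>\<exists> p) = False"

definition universal :: "fm \<Rightarrow> bool" where
  "universal p \<longleftrightarrow> (\<exists>n q. quantifier_free q \<and> p = (Forall ^^ n) q)"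

subsection \<open>Semantics\<close>

text \<open>The domain of an interpretation is the whole type \<^typ>\<open>'a\<close>.\<close>

record 'a interp =
  i_zero :: 'a
  i_one :: 'a
  i_add :: "'a \<Rightarrow> 'a \<Rightarrow> 'a"
  i_mul :: "'a \<Rightarrow> 'a \<Rightarrow> 'a"
  i_le :: "'a \<Rightarrow> 'a \<Rightarrow> bool"

primrec val_tm :: "'a interp \<Rightarrow> (nat \<Rightarrow> 'a) \<Rightarrow> tm \<Rightarrow> 'a" where
  "val_tm M e (Var i) = e i"
| "val_tm M e \<^bold>0 = i_zero M"
| "val_tm M e \<^bold>1 = i_one M"
| "val_tm M e (s \<^bold>+ t) = i_add M (val_tm M e s) (val_tm M e t)"
| "val_tm M e (s \<^bold>* t) = i_mul M (val_tm M e s) (val_tm M e t)"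

primrec sat :: "'a interp \<Rightarrow> (nat \<Rightarrow> 'a) \<Rightarrow> fm \<Rightarrow> bool" where
  "sat M e \<^bold>\<bottom> \<longleftrightarrow> False"
| "sat M e (s \<^bold>= t) \<longleftrightarrow> val_tm M e s = val_tm M e t"
| "sat M e (s \<^bold>\<le> t) \<longleftrightarrow> i_le M (val_tm M e s) (val_tm M e t)"
| "sat M e (p \<^bold>\<longrightarrow> q) \<longleftrightarrow> (sat M e p \<longrightarrow> sat M e q)"
| "sat M e (p \<^bold>\<and> q) \<longleftrightarrow> sat M e p \<and> sat M e q"
| "sat M e (p \<^bold>\<or> q) \<longleftrightarrow> sat M e p \<or> sat M e q"
| "sat M e (\<^bold>\<forall> p) \<longleftrightarrow> (\<forall>a. sat M (case_nat a e) p)"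
| "sat M e (\<^bold>\<exists> p) \<longleftrightarrow> (\<exists>a. sat M (case_nat a e) p)"

definition true_in :: "'a interp \<Rightarrow> fm \<Rightarrow> bool" where
  "true_in M p \<longleftrightarrow> (\<forall>e. sat M e p)"

definition std_model :: "nat interp" where
  "std_model = \<lparr>i_zero = 0, i_one = 1, i_add = (+), i_mul = (*), i_le = (\<le>)\<rparr>"

definition Th_univ :: "'a interp \<Rightarrow> fm set" where
  "Th_univ M = {p. sentence p \<and> universal p \<and> true_in M p}"

section \<open>The theory \<open>PA\<^sub>s\<^sub>m\<^sub>u\<^sup>-\<close>\<close>

definition lt :: "tm \<Rightarrow> tm \<Rightarrow> fm" (infix "\<^bold><" 75) where
  "s \<^bold>< t = ((s \<^bold>\<le> t) \<^bold>\<and> \<^bold>\<not> (s \<^bold>= t))"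

definition divides :: "tm \<Rightarrow> tm \<Rightarrow> fm" (infix "\<^bold>dvd" 75) where
  "s \<^bold>dvd t = (\<^bold>\<exists> (Var 0 \<^bold>* lift_tm s \<^bold>= lift_tm t))"

definition two :: tm ("\<^bold>2") where
  "\<^bold>2 = \<^bold>1 \<^bold>+ \<^bold>1"

definition pow2 :: "tm \<Rightarrow> fm" where
  "pow2 t = (\<^bold>\<forall> (Var 0 \<^bold>dvd lift_tm t \<^bold>\<longrightarrow> Var 0 \<^bold>= \<^bold>1 \<^bold>\<or> \<^bold>2 \<^bold>dvd Var 0))"

text \<open>In the two axioms that begin or end with an existential formula, \<open>Var 0\<close> is the bound variable
  and \<open>lift_tm\<close> takes the free variables past the quantifier.\<close>

definition PA_smu :: "fm set" where
  "PA_smu = univ_closure `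
    (let x = Var 0; y = Var 1; z = Var 2 in
     {x \<^bold>+ \<^bold>0 \<^bold>= x,
      x \<^bold>+ y \<^bold>= y \<^bold>+ x,
      (x \<^bold>+ y) \<^bold>+ z \<^bold>= x \<^bold>+ (y \<^bold>+ z),
      x \<^bold>* \<^bold>1 \<^bold>= x,
      x \<^bold>* y \<^bold>= y \<^bold>* x,
      (x \<^bold>* y) \<^bold>* z \<^bold>= x \<^bold>* (y \<^bold>* z),
      x \<^bold>* (y \<^bold>+ z) \<^bold>= x \<^bold>* y \<^bold>+ x \<^bold>* z,
      x \<^bold>\<le> y \<^bold>\<or> y \<^bold>\<le> x,
      x \<^bold>\<le> y \<^bold>\<and> y \<^bold>\<le> z \<^bold>\<longrightarrow> x \<^bold>\<le> z,
      \<^bold>\<not> (x \<^bold>+ \<^bold>1 \<^bold>\<le> x),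
      y \<^bold>\<le> x \<^bold>\<longrightarrow> y \<^bold>= x \<^bold>\<or> y \<^bold>+ \<^bold>1 \<^bold>\<le> x,
      y \<^bold>\<le> x \<^bold>\<longrightarrow> y \<^bold>+ z \<^bold>\<le> x \<^bold>+ z,
      y \<^bold>\<le> x \<^bold>\<longrightarrow> y \<^bold>* z \<^bold>\<le> x \<^bold>* z,
      y \<^bold>\<le> x \<^bold>\<longrightarrow> \<^bold>\<exists> (lift_tm x \<^bold>= lift_tm y \<^bold>+ Var 0),
      \<^bold>\<exists> (pow2 (Var 0) \<^bold>\<and> Var 0 \<^bold>\<le> lift_tm x \<^bold>+ \<^bold>1 \<^bold>\<and> lift_tm x \<^bold>+ \<^bold>1 \<^bold>< \<^bold>2 \<^bold>* Var 0),
      pow2 x \<^bold>\<and> pow2 y \<^bold>\<and> x \<^bold>\<le> y \<^bold>\<longrightarrow> x \<^bold>dvd y})"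

text \<open>Outside the existential quantifiers, \<open>x\<close> is \<open>Var 1\<close> and \<open>y\<close> is \<open>Var 0\<close>; inside, \<open>x, y, q, r\<close>
  are \<open>Var 3\<close>, \<open>Var 2\<close>, \<open>Var 1\<close>, \<open>Var 0\<close>.\<close>

definition pa17 :: fm where
  "pa17 = (\<^bold>\<forall> (\<^bold>\<forall> (\<^bold>\<not> (Var 0 \<^bold>= \<^bold>0) \<^bold>\<longrightarrow>
     \<^bold>\<exists> (\<^bold>\<exists> (Var 0 \<^bold>< Var 2 \<^bold>\<and> Var 3 \<^bold>= Var 1 \<^bold>* Var 2 \<^bold>+ Var 0)))))"

end

theory Submission
  imports Defs "HOL-Computational_Algebra.Polynomial"
begin

text \<open>The independence is witnessed by the polynomials in \<open>X\<close> that are nonnegative for large \<open>X\<close>,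
  have dyadic rational coefficients and an integer constant term. Reading \<open>X\<close> as \<open>2 ^ n\<close> for large
  \<open>n\<close> turns them into natural numbers and eventually decides every atomic formula, so all universal
  truths of the standard model carry over. In the model, the powers of two are exactly the monomials
  \<open>2\<^sup>k X\<^sup>j\<close> with \<open>k\<close> an integer, nonnegative if \<open>j = 0\<close>, and there are enough of them because dyadic
  coefficients are allowed above the constant term. But \<open>X\<close> cannot be divided by \<open>3\<close> with remainder,
  because \<open>1/3\<close> is not dyadic.\<close>

subsection \<open>Soundness\<close>

lemma val_tm_subst: "val_tm M e (subst_tm \<sigma> t) = val_tm M (\<lambda>i. val_tm M e (\<sigma> i)) t"
  by (induction t) auto

lemma val_lift_tm [simp]: "val_tm M (case_nat a e) (lift_tm t) = val_tm M e t"
  by (simp add: lift_tm_def val_tm_subst)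

lemma val_under_binder:
  "(\<lambda>i. val_tm M (case_nat a e) (under_binder \<sigma> i)) = case_nat a (\<lambda>i. val_tm M e (\<sigma> i))"
  by (rule ext) (simp add: under_binder_def split: nat.split)

lemma sat_subst: "sat M e (subst \<sigma> p) \<longleftrightarrow> sat M (\<lambda>i. val_tm M e (\<sigma> i)) p"
  by (induction p arbitrary: e \<sigma>) (simp_all add: val_tm_subst val_under_binder)

lemma sat_lift [simp]: "sat M (case_nat a e) (lift p) \<longleftrightarrow> sat M e p"
  by (simp add: lift_def sat_subst)

lemma sat_inst: "sat M e (inst t p) \<longleftrightarrow> sat M (case_nat (val_tm M e t) e) p"
proof -
  have "(\<lambda>i. val_tm M e (case_nat t Var i)) = case_nat (val_tm M e t) e"
    by (rule ext) (simp split: nat.split)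
  then show ?thesis
    by (simp add: inst_def sat_subst)
qed

text \<open>The environment has to vary in the induction: the premises of \<open>AllI\<close> and
  \<open>ExE\<close> speak of lifted contexts, which are evaluated in
  \<open>case_nat a e\<close>.\<close>

theorem soundness: "\<Gamma> \<turnstile> p \<Longrightarrow> (\<And>q. q \<in> \<Gamma> \<Longrightarrow> sat M e q) \<Longrightarrow> sat M e p"
proof (induction arbitrary: e rule: provable.induct)
  case (Classical p \<Gamma>)
  then show ?case by (metis insert_iff sat.simps(1,4))
next
  case (AllI \<Gamma> p)
  have "sat M (case_nat a e) p" for a
    using AllI.prems by (intro AllI.IH) auto
  then show ?case by simp
next
  case (ExE \<Gamma> p q)
  from ExE.IH(1)[OF ExE.prems] obtain a where "sat M (case_nat a e) p"
    by auto
  then have "sat M (case_nat a e) (lift q)"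
    using ExE.prems by (intro ExE.IH(2)) auto
  then show ?case by simp
next
  case (EqSubst \<Gamma> s t p)
  then show ?case by (simp add: sat_inst)
next
  case (DisE \<Gamma> p q r)
  then show ?case by (metis insert_iff sat.simps(6))
qed (auto simp: sat_inst)

lemma true_in_Forall: "true_in M (Forall p) \<longleftrightarrow> true_in M p"
proof
  assume *: "true_in M (Forall p)"
  \<comment> \<open>Every environment is the extension of its own tail by its head.\<close>
  have "sat M (case_nat (e 0) (\<lambda>i. e (Suc i))) p" for e
    using * by (simp add: true_in_def)
  moreover have "case_nat (e 0) (\<lambda>i. e (Suc i)) = e" for e :: "nat \<Rightarrow> 'a"
    by (rule ext) (simp split: nat.split)
  ultimately show "true_in M p"
    by (simp add: true_in_def)
qed (simp add: true_in_def)

lemma true_in_Foralls: "true_in M ((Forall ^^ n) p) \<longleftrightarrow> true_in M p"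
  by (induction n) (simp_all add: true_in_Forall)

lemma true_in_univ_closure: "true_in M (univ_closure p) \<longleftrightarrow> true_in M p"
  by (simp add: univ_closure_def true_in_Foralls)

subsection \<open>Dyadic rationals\<close>

text \<open>The ring Z[1/2], placed inside the reals so that the growth bound for real polynomials
  applies later.\<close>

definition dyadics :: "real set" where
  "dyadics = {c. \<exists>k. c * 2 ^ k \<in> \<int>}"

lemma Ints_dyadic: "c \<in> \<int> \<Longrightarrow> c \<in> dyadics"
  unfolding dyadics_def by (auto intro!: exI[of _ 0])

lemma power_ratio_dyadic: "2 ^ k / 2 ^ s \<in> dyadics"
  unfolding dyadics_def by (auto intro!: exI[of _ s])

text \<open>Denominators may be enlarged. This gives common denominators, and later it makes a
  coefficient integral after scaling by any large power of two.\<close>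

lemma dyadics_scale:
  assumes "c * 2 ^ k \<in> \<int>" "k \<le> n"
  shows "c * 2 ^ n \<in> (\<int> :: real set)"
proof -
  have "c * 2 ^ n = (c * 2 ^ k) * 2 ^ (n - k)"
    using assms(2) by (simp flip: power_add)
  then show ?thesis
    using Ints_mult[OF assms(1), of "2 ^ (n - k)"] by (simp only:) simp
qed

lemma dyadics_add: "c \<in> dyadics \<Longrightarrow> d \<in> dyadics \<Longrightarrow> c + d \<in> dyadics"
proof -
  assume "c \<in> dyadics" "d \<in> dyadics"
  then obtain k l where "c * 2 ^ k \<in> \<int>" "d * 2 ^ l \<in> \<int>"
    by (auto simp: dyadics_def)
  then have "c * 2 ^ max k l \<in> \<int>" "d * 2 ^ max k l \<in> \<int>"
    by (auto intro: dyadics_scale)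
  then have "(c + d) * 2 ^ max k l \<in> \<int>"
    by (simp add: distrib_right)
  then show ?thesis
    unfolding dyadics_def by blast
qed

lemma dyadics_mult: "c \<in> dyadics \<Longrightarrow> d \<in> dyadics \<Longrightarrow> c * d \<in> dyadics"
proof -
  assume "c \<in> dyadics" "d \<in> dyadics"
  then obtain k l where "c * 2 ^ k \<in> \<int>" "d * 2 ^ l \<in> \<int>"
    by (auto simp: dyadics_def)
  then have "(c * 2 ^ k) * (d * 2 ^ l) \<in> \<int>"
    by (rule Ints_mult)
  then have "(c * d) * 2 ^ (k + l) \<in> \<int>"
    by (simp add: power_add mult_ac)
  then show ?thesis
    unfolding dyadics_def by blast
qed

lemma dyadics_minus: "c \<in> dyadics \<Longrightarrow> - c \<in> dyadics"
  unfolding dyadics_def by auto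

lemma dyadics_diff: "c \<in> dyadics \<Longrightarrow> d \<in> dyadics \<Longrightarrow> c - d \<in> dyadics"
  using dyadics_add[OF _ dyadics_minus, of c d] by simp

lemma dyadics_sum: "(\<And>i. i \<in> A \<Longrightarrow> f i \<in> dyadics) \<Longrightarrow> sum f A \<in> dyadics"
  by (induction A rule: infinite_finite_induct) (auto intro: dyadics_add Ints_dyadic)

lemma odd_times_power_of_two:
  assumes "z \<noteq> (0::int)"
  obtains m k where "odd m" "z = m * 2 ^ k"
  using assms
proof (induction "nat \<bar>z\<bar>" arbitrary: z thesis rule: less_induct)
  case less
  show ?case
  proof (cases "even z")
    case True
    then obtain w where w: "z = 2 * w" by blast
    then have "nat \<bar>w\<bar> < nat \<bar>z\<bar>" "w \<noteq> 0"
      using less.prems by auto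
    then obtain m k where "odd m" "w = m * 2 ^ k"
      using less.hyps by blast
    then show ?thesis
      using w by (intro less.prems(1)[of m "Suc k"]) auto
  next
    case False
    then show ?thesis
      using less.prems(1)[of z 0] by simp
  qed
qed

text \<open>Clear the denominator and split the resulting integer into an odd part and a power of
  two. The last clause is for monomials of degree 0, whose coefficient must be an integer.\<close>

lemma dyadic_decomposition:
  assumes "c \<in> dyadics" "c \<noteq> 0"
  obtains m k s where "odd m" "c = of_int m * (2 ^ k / 2 ^ s)" "c \<in> \<int> \<Longrightarrow> s = 0"
proof -
  obtain s where s: "c * 2 ^ s \<in> \<int>" "c \<in> \<int> \<Longrightarrow> s = 0"
    using assms(1) unfolding dyadics_def by (cases "c \<in> \<int>") (force intro: that[of 0])+
  then obtain z where z: "c * 2 ^ s = of_int z"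
    by (auto elim: Ints_cases)
  then have "z \<noteq> 0"
    using assms(2) by auto
  then obtain m k where mk: "odd m" "z = m * 2 ^ k"
    by (rule odd_times_power_of_two)
  have "c = of_int m * (2 ^ k / 2 ^ s)"
    using z mk(2) by (simp add: field_simps)
  then show ?thesis
    using that mk(1) s(2) by blast
qed

lemma third_not_dyadic: "1 / 3 \<notin> dyadics"
proof
  assume "1 / 3 \<in> dyadics"
  then obtain k z where "1 / 3 * 2 ^ k = real_of_int z"
    by (auto simp: dyadics_def elim: Ints_cases)
  then have "real_of_int (2 ^ k) = real_of_int (3 * z)"
    by simp
  then have "2 ^ k = 3 * z"
    by (simp only: of_int_eq_iff)
  then have "(3::int) dvd 2 ^ k"
    by simp
  moreover have "coprime (3::int) (2 ^ k)"
    by (simp add: coprime_right_2_iff_odd)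
  ultimately have "is_unit (3::int)"
    by (meson coprime_absorb_left)
  then show False by simp
qed

text \<open>Clearing denominators makes \<open>a\<close> a divisor of a power of two.\<close>

lemma odd_factor_of_power_of_two:
  assumes "real_of_int a * b = 2 ^ k / 2 ^ s" "b \<in> dyadics" "a > 0" "odd a"
  shows "a = 1"
proof -
  obtain l z where z: "b * 2 ^ l = real_of_int z"
    using assms(2) by (auto simp: dyadics_def elim: Ints_cases)
  have "real_of_int (a * z * 2 ^ s) = (real_of_int a * b) * 2 ^ s * 2 ^ l"
    using z by (simp add: mult_ac)
  also have "\<dots> = real_of_int (2 ^ (k + l))"
    by (simp add: assms(1) power_add)
  finally have "a * z * 2 ^ s = 2 ^ (k + l)"
    by (simp only: of_int_eq_iff)
  then have "a dvd 2 ^ (k + l)"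
    by (metis dvd_triv_left mult.assoc)
  moreover have "coprime a (2 ^ (k + l))"
    using assms(4) by simp
  ultimately have "is_unit a"
    by (meson coprime_absorb_left)
  then show ?thesis
    using assms(3) by simp
qed

subsection \<open>Polynomials with dyadic coefficients\<close>

text \<open>The library orders polynomials by the leading coefficient of their difference, that is,
  by their values at large arguments.\<close>

lemma poly_nonneg_iff: "0 \<le> (p :: 'a :: linordered_idom poly) \<longleftrightarrow> 0 \<le> lead_coeff p"
  by (auto simp: less_eq_poly_def pos_poly_def le_less)

lemma poly_pos_iff: "0 < (p :: 'a :: linordered_idom poly) \<longleftrightarrow> 0 < lead_coeff p"
  by (simp add: less_poly_def pos_poly_def)

lemma poly_less_iff: "p < (q :: 'a :: linordered_idom poly) \<longleftrightarrow> 0 < lead_coeff (q - p)"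
  by (simp add: less_poly_def pos_poly_def)

lemma monom_nonneg_iff: "0 \<le> monom (c :: 'a :: linordered_idom) j \<longleftrightarrow> 0 \<le> c"
  by (simp only: poly_nonneg_iff lead_coeff_monom)

lemma monom_pos_iff: "0 < monom (c :: 'a :: linordered_idom) j \<longleftrightarrow> 0 < c"
  by (simp only: poly_pos_iff lead_coeff_monom)

text \<open>The carrier of the model. Integral constant terms make the order discrete; dyadic
  coefficients elsewhere let monomials of positive degree be halved.\<close>

definition dyadic_polys :: "real poly set" where
  "dyadic_polys = {p. 0 \<le> p \<and> coeff p 0 \<in> \<int> \<and> (\<forall>i. coeff p i \<in> dyadics)}"

lemma dyadic_polys_zero: "0 \<in> dyadic_polys"
  by (auto simp: dyadic_polys_def intro: Ints_dyadic)

lemma dyadic_polys_one: "1 \<in> dyadic_polys"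
  by (auto simp: dyadic_polys_def intro: Ints_dyadic)

lemma dyadic_polys_add: "p \<in> dyadic_polys \<Longrightarrow> q \<in> dyadic_polys \<Longrightarrow> p + q \<in> dyadic_polys"
  by (auto simp: dyadic_polys_def intro: dyadics_add)

lemma dyadic_polys_mult: "p \<in> dyadic_polys \<Longrightarrow> q \<in> dyadic_polys \<Longrightarrow> p * q \<in> dyadic_polys"
  by (auto simp: dyadic_polys_def coeff_mult intro!: dyadics_sum dyadics_mult)

lemma dyadic_polys_diff:
  "p \<in> dyadic_polys \<Longrightarrow> q \<in> dyadic_polys \<Longrightarrow> q \<le> p \<Longrightarrow> p - q \<in> dyadic_polys"
  by (auto simp: dyadic_polys_def intro: dyadics_diff)

lemma dyadic_polys_numeral: "numeral n \<in> dyadic_polys"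
  by (auto simp: dyadic_polys_def poly_nonneg_iff numeral_poly coeff_pCons
      intro: Ints_dyadic split: nat.split)

lemma monom_in_dyadic_polys:
  "c \<in> dyadics \<Longrightarrow> 0 \<le> c \<Longrightarrow> (j = 0 \<Longrightarrow> c \<in> \<int>) \<Longrightarrow> monom c j \<in> dyadic_polys"
  by (auto simp: dyadic_polys_def monom_nonneg_iff intro: Ints_dyadic)

text \<open>Discreteness of the order. A nonzero constant in the carrier is a positive integer; in
  positive degree, subtracting 1 leaves the leading coefficient alone.\<close>

lemma dyadic_polys_ge_one:
  assumes "p \<in> dyadic_polys" "p \<noteq> 0"
  shows "1 \<le> p"
proof (cases "degree p = 0")
  case True
  then obtain c where c: "p = [:c:]"
    by (metis degree_eq_zeroE)
  then have "c \<in> \<int>" "0 < c"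
    using assms by (auto simp: dyadic_polys_def poly_nonneg_iff)
  then have "1 \<le> c"
    by (auto elim!: Ints_cases)
  then show ?thesis
    using poly_nonneg_iff[of "p - 1"] c by (simp add: one_pCons less_eq_poly_def pos_poly_pCons)
next
  case False
  then have "lead_coeff (-1 + p) = lead_coeff p"
    by (intro lead_coeff_add_le) simp
  moreover have "0 \<le> lead_coeff p"
    using assms by (simp add: dyadic_polys_def poly_nonneg_iff)
  ultimately show ?thesis
    using poly_nonneg_iff[of "-1 + p"] by simp
qed

subsection \<open>Powers of two\<close>

text \<open>The meaning of \<open>pow2\<close> when the quantifiers range over the model.\<close>

definition poly_pow2 :: "real poly \<Rightarrow> bool" where
  "poly_pow2 x \<longleftrightarrow> (\<forall>y\<in>dyadic_polys. (\<exists>z\<in>dyadic_polys. z * y = x) \<longrightarrow>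
     y = 1 \<or> (\<exists>z\<in>dyadic_polys. z * 2 = y))"

lemma mult_two_poly: "p * 2 = smult 2 (p :: real poly)"
  by (simp add: numeral_poly)

text \<open>\<open>X\<close> is prime: while it divides the product, it divides one of the factors
  and can be cancelled there.\<close>

lemma monom_factors:
  fixes p q :: "'a :: idom poly"
  assumes "p * q = monom c j" "c \<noteq> 0"
  obtains a b i k where "p = monom a i" "q = monom b k"
  using assms(1)
proof (induction j arbitrary: p q thesis)
  case 0
  then have pq: "p * q = [:c:]"
    by (simp add: monom_0)
  then have "p \<noteq> 0" "q \<noteq> 0"
    using assms(2) by auto
  then have "degree p = 0" "degree q = 0"
    using pq degree_mult_eq[of p q] by auto
  then show ?case
    using 0(1)[of _ 0 _ 0] by (metis degree_eq_zeroE monom_0)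
next
  case (Suc j)
  have pq: "p * q = pCons 0 (monom c j)"
    using Suc.prems(2) by (simp add: monom_Suc)
  then have "poly p 0 = 0 \<or> poly q 0 = 0"
    by (metis mult_eq_0_iff poly_0_coeff_0 coeff_pCons_0 poly_mult)
  then show ?case
  proof
    assume "poly p 0 = 0"
    then obtain r where r: "p = pCons 0 r"
      by (metis coeff_pCons_0 pCons_cases poly_0_coeff_0)
    then have "r * q = monom c j"
      using pq by simp
    then show ?thesis
      using Suc.IH Suc.prems(1) r by (metis monom_Suc)
  next
    assume "poly q 0 = 0"
    then obtain r where r: "q = pCons 0 r"
      by (metis coeff_pCons_0 pCons_cases poly_0_coeff_0)
    then have "p * r = monom c j"
      using pq by simp
    then show ?thesis
      using Suc.IH Suc.prems(1) r by (metis monom_Suc)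
  qed
qed

text \<open>A divisor of a monomial is a monomial \<open>a X^i\<close>. For \<open>i > 0\<close> it
  can be halved, since \<open>a / 2\<close> is again dyadic. For \<open>i = 0\<close> the positive
  integer \<open>a\<close> is even or, by \<open>odd_factor_of_power_of_two\<close>, equal to
  1.\<close>

lemma poly_pow2_monom: "poly_pow2 (monom (2 ^ k / 2 ^ s) j)"
  unfolding poly_pow2_def
proof (intro ballI impI)
  fix y assume y: "y \<in> dyadic_polys"
  assume "\<exists>z\<in>dyadic_polys. z * y = monom (2 ^ k / 2 ^ s) j"
  then obtain z where z: "z \<in> dyadic_polys" "z * y = monom (2 ^ k / 2 ^ s) j"
    by blast
  obtain a b i l where zy: "z = monom b l" "y = monom a i"
    using monom_factors[OF z(2)] by (metis power_not_zero zero_neq_numeral divide_eq_0_iff)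
  have eq: "monom (b * a) (l + i) = monom (2 ^ k / 2 ^ s) j"
    using z(2) zy by (simp add: mult_monom)
  then have ba: "b * a = 2 ^ k / 2 ^ s"
    by (metis lead_coeff_monom)
  \<comment> \<open>The coefficients of a monomial are conditional expressions, so the dyadic
    condition is specialised at the exponent to reach \<open>a\<close>, and likewise
    \<open>b\<close>.\<close>
  have a: "a \<in> dyadics" "0 \<le> a" "i = 0 \<Longrightarrow> a \<in> \<int>"
    using y unfolding zy(2) dyadic_polys_def
    by (auto simp: monom_nonneg_iff dest!: spec[of "\<lambda>n. (if i = n then a else 0) \<in> dyadics" i])
  have b: "b \<in> dyadics"
    using z(1) zy(1) unfolding dyadic_polys_def
    by (auto dest!: spec[of "\<lambda>n. (if l = n then b else 0) \<in> dyadics" l])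
  have half: "\<exists>z\<in>dyadic_polys. z * 2 = y" if "a / 2 \<in> dyadics" "i = 0 \<Longrightarrow> a / 2 \<in> \<int>"
  proof -
    have "monom (a / 2) i \<in> dyadic_polys"
      using that a by (intro monom_in_dyadic_polys) auto
    moreover have "monom (a / 2) i * 2 = y"
      by (simp add: mult_two_poly smult_monom zy)
    ultimately show ?thesis
      by blast
  qed
  have half_dyadic: "a / 2 \<in> dyadics"
    using dyadics_mult[OF a(1) power_ratio_dyadic[of 0 1]] by simp
  show "y = 1 \<or> (\<exists>z\<in>dyadic_polys. z * 2 = y)"
  proof (cases "i = 0")
    case True
    then obtain n where n: "a = real_of_int n"
      using a by (auto elim: Ints_cases)
    have "a \<noteq> 0"
      using ba by auto
    then have "n > 0"
      using a n by simp
    show ?thesis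
    proof (cases "even n")
      case True
      then have "a / 2 \<in> \<int>"
        using n by (auto elim!: evenE)
      then show ?thesis
        using half half_dyadic by simp
    next
      case False
      then have "n = 1"
        using odd_factor_of_power_of_two[of n b k s] ba b n \<open>n > 0\<close> by (simp add: mult.commute)
      then show ?thesis
        using zy(2) n True by simp
    qed
  qed (use half half_dyadic in simp)
qed

text \<open>Split off the monomial \<open>u\<close> that carries the exact power of \<open>X\<close>
  and the power of two in the lowest coefficient. The cofactor \<open>h\<close> has an odd constant
  term, so it is not twice an element of the carrier and must be 1.\<close>

lemma poly_pow2_cases:
  assumes x: "x \<in> dyadic_polys" "poly_pow2 x"
  obtains k s j where "x = monom (2 ^ k / 2 ^ s) j" "j = 0 \<Longrightarrow> s = 0"
proof -
  \<comment> \<open>Everything divides 0, in particular 3; but 3 is not 1, and its half has no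
    integral constant term.\<close>
  have "x \<noteq> 0"
  proof
    assume "x = 0"
    then have "(3 :: real poly) = 1 \<or> (\<exists>z\<in>dyadic_polys. z * 2 = 3)"
      using x(2) dyadic_polys_zero dyadic_polys_numeral[of "num.Bit1 num.One"]
      by (auto simp: poly_pow2_def)
    then obtain z :: "real poly" where z: "z \<in> dyadic_polys" "z * 2 = 3"
      by auto
    have "coeff (z * 2) 0 = coeff 3 0"
      using z by simp
    then have "coeff z 0 * 2 = 3"
      by (simp add: mult_two_poly numeral_poly)
    moreover obtain n where "coeff z 0 = real_of_int n"
      using z(1) by (auto simp: dyadic_polys_def elim: Ints_cases)
    ultimately have "real_of_int (n * 2) = real_of_int 3"
      by simp
    then have "n * 2 = 3"
      by (simp only: of_int_eq_iff)
    then show False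
      by presburger
  qed
  define j where "j = order 0 x"
  obtain g where g: "x = monom 1 j * g" "coeff g 0 \<noteq> 0"
    using order_decomp[OF \<open>x \<noteq> 0\<close>, of 0]
    by (auto simp: j_def monom_altdef dvd_iff_poly_eq_0 poly_0_coeff_0)
  have coeff_g: "coeff g i = coeff x (j + i)" for i
    by (simp add: g(1) coeff_monom_mult)
  obtain m k s where m: "odd m" "coeff g 0 = of_int m * (2 ^ k / 2 ^ s)" "coeff g 0 \<in> \<int> \<Longrightarrow> s = 0"
    using dyadic_decomposition[of "coeff g 0"] g(2) x(1) by (auto simp: coeff_g dyadic_polys_def)
  \<comment> \<open>For \<open>j = 0\<close> the lowest coefficient is the constant term of
    \<open>x\<close>, hence an integer.\<close>
  have s: "s = 0" if "j = 0"
    using m(3) x(1) coeff_g[of 0] that by (simp add: dyadic_polys_def)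
  define u where "u = monom (2 ^ k / 2 ^ s :: real) j"
  \<comment> \<open>The scaling turns the constant term into the integer \<open>m\<close>, as
    membership requires; that of \<open>g\<close> may be a proper fraction.\<close>
  define h where "h = smult (2 ^ s / 2 ^ k) g"
  have x_eq: "u * h = x"
    by (simp add: u_def h_def g(1) smult_monom_mult flip: mult_smult_left) (simp add: smult_monom)
  have u: "u \<in> dyadic_polys"
    unfolding u_def using s by (intro monom_in_dyadic_polys power_ratio_dyadic) auto
  have "0 < u"
    by (simp add: u_def monom_pos_iff)
  have h0: "coeff h 0 = of_int m"
    by (simp add: h_def m(2))
  have "0 \<le> h"
    using x(1) \<open>0 < u\<close> unfolding dyadic_polys_def x_eq[symmetric] by (simp add: zero_le_mult_iff)
  then have h: "h \<in> dyadic_polys"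
    using h0 x(1) unfolding dyadic_polys_def mem_Collect_eq h_def coeff_smult coeff_g
    by (auto intro!: dyadics_mult power_ratio_dyadic simp del: times_divide_eq_left)
  have "\<not> (\<exists>z\<in>dyadic_polys. z * 2 = h)"
  proof
    assume "\<exists>z\<in>dyadic_polys. z * 2 = h"
    then obtain z where z: "z \<in> dyadic_polys" "z * 2 = h"
      by blast
    then obtain n where n: "coeff z 0 = real_of_int n"
      by (auto simp: dyadic_polys_def elim: Ints_cases)
    have "coeff z 0 * 2 = of_int m"
      using h0 by (simp flip: z(2) add: mult_two_poly)
    then have "real_of_int (n * 2) = of_int m"
      using n by simp
    then have "n * 2 = m"
      by (simp only: of_int_eq_iff)
    then show False
      using m(1) by auto
  qed
  then have "h = 1"
    using x(2) h u x_eq by (auto simp: poly_pow2_def)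
  then show ?thesis
    using that[of k s j] x_eq s by (auto simp: u_def)
qed

text \<open>The quotient is \<open>c X^(i - j)\<close>. Higher degree dominates in the order, so
  \<open>j \<le> i\<close>. If the degrees agree, \<open>x \<le> y\<close> compares the two
  coefficients and makes \<open>c\<close> an integral power of two.\<close>

lemma poly_pow2_dvd:
  assumes "x \<in> dyadic_polys" "y \<in> dyadic_polys" "poly_pow2 x" "poly_pow2 y" "x \<le> y"
  shows "\<exists>z\<in>dyadic_polys. z * x = y"
proof -
  obtain k s j where x: "x = monom (2 ^ k / 2 ^ s) j" "j = 0 \<Longrightarrow> s = 0"
    using poly_pow2_cases assms by metis
  obtain l t i where y: "y = monom (2 ^ l / 2 ^ t) i" "i = 0 \<Longrightarrow> t = 0"
    using poly_pow2_cases assms by metis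
  define c where "c = (2 ^ (l + s) / 2 ^ (k + t) :: real)"
  have c: "c * (2 ^ k / 2 ^ s) = 2 ^ l / 2 ^ t"
    by (simp add: c_def power_add)
  have ji: "j \<le> i"
  proof (rule ccontr)
    assume "\<not> j \<le> i"
    then have "degree (- y) < degree x"
      by (simp add: x(1) y(1) degree_monom_eq)
    then have "lead_coeff (- y + x) = lead_coeff x"
      by (rule lead_coeff_add_le)
    then have "lead_coeff (x - y) = lead_coeff x"
      by simp
    then have "y < x"
      using lead_coeff_monom[of "2 ^ k / 2 ^ s :: real" j] unfolding x(1)[symmetric] poly_less_iff
      by simp
    then show False
      using assms(5) by simp
  qed
  have "c \<in> \<int>" if "i = j"
  proof -
    have "y - x = monom (2 ^ l / 2 ^ t - 2 ^ k / 2 ^ s) i"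
      using that by (simp add: x(1) y(1) diff_monom)
    then have "2 ^ k / 2 ^ s \<le> (2 ^ l / 2 ^ t :: real)"
      using assms(5) monom_nonneg_iff by (metis diff_ge_0_iff_ge)
    then have "(2::real) ^ (k + t) \<le> 2 ^ (l + s)"
      by (simp add: power_add field_simps)
    then have "k + t \<le> l + s"
      by simp
    then have "c = 2 ^ (l + s - (k + t))"
      unfolding c_def by (simp only: power_diff)
    then show ?thesis
      by simp
  qed
  then have "monom c (i - j) \<in> dyadic_polys"
    using ji by (intro monom_in_dyadic_polys) (auto simp: c_def intro: power_ratio_dyadic)
  moreover have "monom c (i - j) * x = y"
    using ji c by (simp add: x(1) y(1) mult_monom)
  ultimately show ?thesis
    by blast
qed

text \<open>The candidate \<open>u\<close> has the degree of \<open>x\<close>, and its coefficient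
  is the largest power of two not above the leading coefficient \<open>c\<close>. It fails only if
  \<open>c\<close> equals that power and the lower terms push \<open>x\<close> below
  \<open>u\<close>; then half of \<open>u\<close> works.\<close>

lemma poly_pow2_between:
  assumes x: "x \<in> dyadic_polys" "x \<noteq> 0"
  shows "\<exists>u\<in>dyadic_polys. poly_pow2 u \<and> u \<le> x \<and> x < 2 * u"
proof -
  define j where "j = degree x"
  define c where "c = lead_coeff x"
  have c: "c > 0" "c \<in> dyadics" "j = 0 \<Longrightarrow> c \<in> \<int>"
    using x by (auto simp: c_def j_def dyadic_polys_def poly_nonneg_iff less_le)
  obtain m r s where "c = of_int m * (2 ^ r / 2 ^ s)" and s: "c \<in> \<int> \<Longrightarrow> s = 0"
    using dyadic_decomposition[of c] c by (metis less_irrefl)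
  then have "c * 2 ^ s = of_int (m * 2 ^ r)"
    by simp
  moreover have "c * 2 ^ s > 0"
    using c by simp
  ultimately obtain n where n: "c * 2 ^ s = real n" "n > 0"
    by (metis of_int_0_less_iff of_int_of_nat_eq pos_int_cases)
  obtain k where k: "2 ^ k \<le> n" "n < 2 ^ (k + 1)"
    using ex_power_ivl1[of 2 n] n(2) by auto
  have "real (2 ^ k) \<le> real n" "real n < real (2 ^ (k + 1))"
    using k by (simp_all only: of_nat_le_iff of_nat_less_iff)
  then have c_bounds: "2 ^ k / 2 ^ s \<le> c" "c < 2 * (2 ^ k / 2 ^ s)"
    by (simp_all add: n(1)[symmetric] field_simps)
  define u where "u = monom (2 ^ k / 2 ^ s :: real) j"
  have coeff_diff_monom: "coeff (x - monom d j) j = c - d" for d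
    by (simp add: c_def j_def)
  \<comment> \<open>A difference of degree at most \<open>j\<close> with a nonzero coefficient at
    \<open>j\<close> has it as leading coefficient.\<close>
  have less_monom: "x < monom d j" if "c < d" for d
  proof -
    have "coeff (monom d j - x) j = d - c"
      by (simp add: c_def j_def)
    moreover have "degree (monom d j - x) \<le> j"
      by (simp add: degree_diff_le degree_monom_le j_def)
    ultimately have "lead_coeff (monom d j - x) = d - c"
      using that by (metis diff_gt_0_iff_gt le_antisym le_degree less_irrefl)
    then show ?thesis
      using that by (simp add: poly_less_iff)
  qed
  have monom_less: "monom d j < x" if "d < c" for d
  proof -
    have "degree (x - monom d j) \<le> j"
      by (simp add: degree_diff_le degree_monom_le j_def)
    then have "lead_coeff (x - monom d j) = c - d"
      using that coeff_diff_monom[of d] by (metis diff_gt_0_iff_gt le_antisym le_degree less_irrefl)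
    then show ?thesis
      using that by (simp add: poly_less_iff)
  qed
  have two: "2 * monom d j = monom (2 * d) j" for d :: real
    by (simp add: mult_two_poly[unfolded mult.commute[of _ 2]] smult_monom)
  show ?thesis
  proof (cases "u \<le> x")
    case True
    have "x < 2 * u"
      using less_monom[OF c_bounds(2)] by (simp add: u_def two)
    moreover have "u \<in> dyadic_polys"
      unfolding u_def using s c(3) by (intro monom_in_dyadic_polys power_ratio_dyadic) auto
    ultimately show ?thesis
      using True poly_pow2_monom u_def by blast
  next
    case False
    \<comment> \<open>A constant \<open>x\<close> would be at least \<open>u\<close>. So the degree
      is positive, and halving \<open>u\<close> stays in the carrier.\<close>
    have "j \<noteq> 0"
    proof
      assume "j = 0"
      then have "x = monom c j"
        by (metis c_def degree_0_id j_def monom_0)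
      then have "x - u = monom (c - 2 ^ k / 2 ^ s) j"
        by (simp add: u_def diff_monom)
      then show False
        using False c_bounds monom_nonneg_iff by (metis diff_ge_0_iff_ge)
    qed
    define v where "v = monom (2 ^ k / 2 ^ Suc s :: real) j"
    have "2 * v = u"
      by (simp add: v_def u_def two)
    then have "x < 2 * v"
      using False by simp
    moreover have "2 ^ k / 2 ^ Suc s < (2 ^ k / 2 ^ s :: real)"
      by (simp add: field_simps)
    then have "v < x"
      unfolding v_def using c_bounds(1) by (intro monom_less) linarith
    moreover have "v \<in> dyadic_polys"
      unfolding v_def using \<open>j \<noteq> 0\<close> by (intro monom_in_dyadic_polys power_ratio_dyadic) auto
    ultimately show ?thesis
      using poly_pow2_monom v_def less_imp_le by blast
  qed
qed

subsection \<open>The model\<close>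

text \<open>The domain of an interpretation is a whole type, so the carrier has to become
  one.\<close>

typedef dyadic_poly = dyadic_polys
  using dyadic_polys_zero by blast

definition dyadic_model :: "dyadic_poly interp" where
  "dyadic_model = \<lparr>i_zero = Abs_dyadic_poly 0, i_one = Abs_dyadic_poly 1,
     i_add = (\<lambda>a b. Abs_dyadic_poly (Rep_dyadic_poly a + Rep_dyadic_poly b)),
     i_mul = (\<lambda>a b. Abs_dyadic_poly (Rep_dyadic_poly a * Rep_dyadic_poly b)),
     i_le = (\<lambda>a b. Rep_dyadic_poly a \<le> Rep_dyadic_poly b)\<rparr>"

lemma Rep_dyadic_model [simp]:
  "Rep_dyadic_poly (i_zero dyadic_model) = 0"
  "Rep_dyadic_poly (i_one dyadic_model) = 1"
  "Rep_dyadic_poly (i_add dyadic_model a b) = Rep_dyadic_poly a + Rep_dyadic_poly b"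
  "Rep_dyadic_poly (i_mul dyadic_model a b) = Rep_dyadic_poly a * Rep_dyadic_poly b"
  "i_le dyadic_model a b \<longleftrightarrow> Rep_dyadic_poly a \<le> Rep_dyadic_poly b"
  by (simp_all add: dyadic_model_def Abs_dyadic_poly_inverse dyadic_polys_zero dyadic_polys_one
      dyadic_polys_add dyadic_polys_mult Rep_dyadic_poly)

lemma ex_dyadic_poly: "(\<exists>a. P (Rep_dyadic_poly a)) \<longleftrightarrow> (\<exists>p\<in>dyadic_polys. P p)"
  by (metis Rep_dyadic_poly Rep_dyadic_poly_cases)

lemma all_dyadic_poly: "(\<forall>a. P (Rep_dyadic_poly a)) \<longleftrightarrow> (\<forall>p\<in>dyadic_polys. P p)"
  by (metis Rep_dyadic_poly Rep_dyadic_poly_cases)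

lemma sat_divides:
  "sat dyadic_model e (s \<^bold>dvd t) \<longleftrightarrow> (\<exists>z\<in>dyadic_polys.
     z * Rep_dyadic_poly (val_tm dyadic_model e s) = Rep_dyadic_poly (val_tm dyadic_model e t))"
  by (simp add: divides_def Rep_dyadic_poly_inject[symmetric]
      ex_dyadic_poly[of "\<lambda>z. z * _ = _"])

lemma sat_pow2:
  "sat dyadic_model e (pow2 t) \<longleftrightarrow> poly_pow2 (Rep_dyadic_poly (val_tm dyadic_model e t))"
  by (simp add: pow2_def sat_divides poly_pow2_def two_def Rep_dyadic_poly_inject[symmetric]
      flip: all_dyadic_poly)

text \<open>The algebraic and order laws are inherited from real polynomials. The other axioms rest
  on discreteness, closure under differences, \<open>poly_pow2_between\<close> at
  \<open>1 + x\<close>, and \<open>poly_pow2_dvd\<close>.\<close>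

lemma PA_smu_dyadic_model:
  assumes "p \<in> PA_smu"
  shows "true_in dyadic_model p"
proof -
  note [simp] = sat_divides sat_pow2 lt_def two_def
    Rep_dyadic_poly_inject[symmetric]
  have nonneg: "0 \<le> Rep_dyadic_poly a" for a
    using Rep_dyadic_poly[of a] by (simp add: dyadic_polys_def)
  have pa11: "Rep_dyadic_poly b = Rep_dyadic_poly a"
    if "Rep_dyadic_poly b \<le> Rep_dyadic_poly a" "\<not> 1 + Rep_dyadic_poly b \<le> Rep_dyadic_poly a" for a b
    using dyadic_polys_ge_one[of "Rep_dyadic_poly a - Rep_dyadic_poly b"] that
    by (simp add: dyadic_polys_diff Rep_dyadic_poly algebra_simps) metis
  have pa15: "\<exists>c. Rep_dyadic_poly a = Rep_dyadic_poly c + Rep_dyadic_poly b"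
    if "Rep_dyadic_poly b \<le> Rep_dyadic_poly a" for a b
    unfolding ex_dyadic_poly[of "\<lambda>z. _ = z + _"] using that
    by (intro bexI[of _ "Rep_dyadic_poly a - Rep_dyadic_poly b"])
      (auto intro: dyadic_polys_diff Rep_dyadic_poly)
  have pa19: "\<exists>c. poly_pow2 (Rep_dyadic_poly c) \<and> Rep_dyadic_poly c \<le> 1 + Rep_dyadic_poly a \<and>
      1 + Rep_dyadic_poly a \<le> Rep_dyadic_poly c * 2 \<and>
      1 + Rep_dyadic_poly a \<noteq> Rep_dyadic_poly c * 2" for a
  proof -
    have "1 + Rep_dyadic_poly a \<noteq> 0"
      using nonneg[of a] by (metis add_pos_nonneg less_irrefl zero_less_one)
    then show ?thesis
      using poly_pow2_between[of "1 + Rep_dyadic_poly a"] dyadic_polys_add dyadic_polys_one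
        Rep_dyadic_poly
      unfolding ex_dyadic_poly[of "\<lambda>u. poly_pow2 u \<and> u \<le> _ \<and> _ \<le> u * 2 \<and> _ \<noteq> u * 2"]
      by (metis less_le mult.commute)
  qed
  show ?thesis
    using assms unfolding PA_smu_def Let_def image_insert image_empty insert_iff empty_iff
    by (elim disjE FalseE; simp only: true_in_univ_closure;
        auto simp: true_in_def algebra_simps
        intro: pa11 pa15 pa19 nonneg mult_right_mono mult_left_mono order_trans poly_pow2_dvd
          Rep_dyadic_poly)
qed

text \<open>A remainder below 3 is constant, so comparing the coefficients of \<open>X\<close> would
  give \<open>q\<close> the coefficient 1/3.\<close>

lemma no_division_by_three:
  assumes "q \<in> dyadic_polys" "r \<in> dyadic_polys" "r \<le> 3" "r \<noteq> 3"
  shows "monom 1 1 \<noteq> q * 3 + r"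
proof
  assume *: "monom 1 1 = q * 3 + r"
  have "degree r = 0"
  proof (rule ccontr)
    assume "degree r \<noteq> 0"
    then have "lead_coeff (- 3 + r) = lead_coeff r"
      by (intro lead_coeff_add_le) (simp add: numeral_poly)
    moreover have "0 \<le> lead_coeff r"
      using assms(2) by (simp add: dyadic_polys_def poly_nonneg_iff)
    ultimately have "3 \<le> r"
      using poly_nonneg_iff[of "- 3 + r"] by simp
    then show False
      using assms by simp
  qed
  then have "coeff r 1 = 0"
    by (simp add: coeff_eq_0)
  moreover have "q * 3 = smult 3 q"
    by (simp add: numeral_poly)
  ultimately have "coeff q 1 = 1 / 3"
    using arg_cong[OF *, of "\<lambda>p. coeff p 1"] by simp
  then show False
    using assms(1) third_not_dyadic by (metis (mono_tags, lifting) dyadic_polys_def mem_Collect_eq)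
qed

lemma pa17_fails: "\<not> sat dyadic_model e pa17"
proof
  assume pa17: "sat dyadic_model e pa17"
  obtain x y where xy: "Rep_dyadic_poly x = monom 1 1" "Rep_dyadic_poly y = 3"
    using Abs_dyadic_poly_inverse dyadic_polys_numeral monom_in_dyadic_polys[of 1 1]
    by (metis Ints_1 Ints_dyadic zero_le_one)
  have "y \<noteq> i_zero dyadic_model"
    using xy(2) by (auto simp: Rep_dyadic_poly_inject[symmetric])
  then obtain q r where "r \<noteq> y" "i_le dyadic_model r y"
      "x = i_add dyadic_model (i_mul dyadic_model q y) r"
    using pa17 by (simp add: pa17_def lt_def numeral_2_eq_2 numeral_3_eq_3) metis
  then show False
    using no_division_by_three[of "Rep_dyadic_poly q" "Rep_dyadic_poly r"] xy
    by (auto simp: Rep_dyadic_poly Rep_dyadic_poly_inject[symmetric])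
qed

subsection \<open>Transfer of universal truths\<close>

text \<open>For \<open>i \<ge> 1\<close> the factor \<open>(2 ^ n) ^ i\<close> absorbs the
  denominator of the coefficient once \<open>n\<close> is large; the constant term is integral
  anyway. There are finitely many terms.\<close>

lemma eventually_poly_integer:
  assumes "p \<in> dyadic_polys"
  shows "\<forall>\<^sub>F n in sequentially. poly p (2 ^ n) \<in> \<int>"
proof -
  have "\<forall>\<^sub>F n in sequentially. coeff p i * (2 ^ n) ^ i \<in> \<int>" for i
  proof (cases "i = 0")
    case False
    obtain k where k: "coeff p i * 2 ^ k \<in> \<int>"
      using assms by (auto simp: dyadic_polys_def dyadics_def)
    have "coeff p i * (2 ^ n) ^ i \<in> \<int>" if "n \<ge> k" for n
    proof -
      have "n \<le> n * i"
        using False by simp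
      then have "k \<le> n * i"
        using that by linarith
      then show ?thesis
        using dyadics_scale[OF k] by (simp flip: power_mult)
    qed
    then show ?thesis
      by (auto simp: eventually_sequentially)
  qed (use assms in \<open>auto simp: dyadic_polys_def\<close>)
  then have "\<forall>\<^sub>F n in sequentially. \<forall>i\<in>{..degree p}. coeff p i * (2 ^ n) ^ i \<in> \<int>"
    by (intro eventually_ball_finite) auto
  then show ?thesis
    by eventually_elim (auto simp: poly_altdef intro!: Ints_sum)
qed

lemma eventually_poly_pos:
  fixes p :: "real poly"
  assumes "0 < p"
  shows "\<forall>\<^sub>F n in sequentially. 0 < poly p (2 ^ n)"
proof -
  have pos: "0 < lead_coeff p"
    using assms by (simp add: poly_pos_iff)
  then obtain N where "\<And>x. N \<le> x \<Longrightarrow> lead_coeff p \<le> poly p x"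
    using poly_pinfty_gt_lc by blast
  then have N: "\<And>x. N \<le> x \<Longrightarrow> 0 < poly p x"
    using pos by force
  obtain k where "N < 2 ^ k"
    using real_arch_pow[of 2 N] by auto
  then have "N \<le> 2 ^ n" if "k \<le> n" for n
    using power_increasing[OF that, of "2::real"] \<open>N < 2 ^ k\<close> by linarith
  then show ?thesis
    using N by (auto simp: eventually_sequentially)
qed

lemma eventually_poly_natural:
  assumes "p \<in> dyadic_polys"
  shows "\<forall>\<^sub>F n in sequentially. real (nat \<lfloor>poly p (2 ^ n)\<rfloor>) = poly p (2 ^ n)"
proof -
  have "\<forall>\<^sub>F n in sequentially. 0 \<le> poly p (2 ^ n)"
  proof (cases "p = 0")
    case False
    then show ?thesis
      using assms eventually_mono[OF eventually_poly_pos[of p], of "\<lambda>n. 0 \<le> poly p (2 ^ n)"]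
      by (simp add: dyadic_polys_def less_le)
  qed simp
  then show ?thesis
    using eventually_poly_integer[OF assms]
    by eventually_elim (auto elim!: Ints_cases)
qed

text \<open>For small \<open>n\<close> the value may be negative or fractional, and rounding is only
  a default; by \<open>eventually_poly_natural\<close> it is exact for large
  \<open>n\<close>.\<close>

definition std_env :: "(nat \<Rightarrow> dyadic_poly) \<Rightarrow> nat \<Rightarrow> nat \<Rightarrow> nat" where
  "std_env e n i = nat \<lfloor>poly (Rep_dyadic_poly (e i)) (2 ^ n)\<rfloor>"

text \<open>Evaluation at \<open>2 ^ n\<close> is a ring homomorphism, so only the variables need
  \<open>n\<close> to be large.\<close>

lemma eventually_val_tm:
  "\<forall>\<^sub>F n in sequentially. real (val_tm std_model (std_env e n) t) =
     poly (Rep_dyadic_poly (val_tm dyadic_model e t)) (2 ^ n)"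
proof (induction t)
  case (Var i)
  then show ?case
    using eventually_poly_natural[OF Rep_dyadic_poly] by (simp add: std_env_def)
next
  case (Add s t)
  then show ?case
    by eventually_elim (simp add: std_model_def)
next
  case (Mul s t)
  then show ?case
    by eventually_elim (simp add: std_model_def)
qed (simp_all add: std_model_def)

text \<open>Distinct polynomials differ eventually with a constant sign, which settles the atoms. An
  equivalence is needed because implication reverses its left side.\<close>

lemma eventually_sat_iff:
  "quantifier_free q \<Longrightarrow>
     \<forall>\<^sub>F n in sequentially. sat std_model (std_env e n) q \<longleftrightarrow> sat dyadic_model e q"
proof (induction q)
  case (Eq s t)
  define p where "p = Rep_dyadic_poly (val_tm dyadic_model e s)"
  define r where "r = Rep_dyadic_poly (val_tm dyadic_model e t)"
  have "\<forall>\<^sub>F n in sequentially. poly p (2 ^ n) = poly r (2 ^ n) \<longleftrightarrow> p = r"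
  proof (cases p r rule: linorder_cases)
    case less
    then show ?thesis
      using eventually_poly_pos[of "r - p"] by (simp, elim eventually_mono) auto
  next
    case greater
    then show ?thesis
      using eventually_poly_pos[of "p - r"] by (simp, elim eventually_mono) auto
  qed simp
  then show ?case
    using eventually_val_tm[of e s] eventually_val_tm[of e t]
    by eventually_elim (simp add: p_def r_def Rep_dyadic_poly_inject flip: of_nat_eq_iff[where 'a=real])
next
  case (Le s t)
  define p where "p = Rep_dyadic_poly (val_tm dyadic_model e s)"
  define r where "r = Rep_dyadic_poly (val_tm dyadic_model e t)"
  have "\<forall>\<^sub>F n in sequentially. poly p (2 ^ n) \<le> poly r (2 ^ n) \<longleftrightarrow> p \<le> r"
  proof (cases p r rule: linorder_cases)
    case less
    then show ?thesis
      using eventually_poly_pos[of "r - p"] by (simp, elim eventually_mono) auto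
  next
    case greater
    then show ?thesis
      using eventually_poly_pos[of "p - r"] by (simp, elim eventually_mono) auto
  qed simp
  then have "\<forall>\<^sub>F n in sequentially.
     val_tm std_model (std_env e n) s \<le> val_tm std_model (std_env e n) t \<longleftrightarrow> p \<le> r"
    using eventually_val_tm[of e s] eventually_val_tm[of e t]
    by eventually_elim (simp add: p_def r_def flip: of_nat_le_iff[where 'a=real])
  then show ?case
    by (simp add: p_def r_def) (simp add: std_model_def)
next
  case (Imp p q)
  then have "\<forall>\<^sub>F n in sequentially. sat std_model (std_env e n) p \<longleftrightarrow> sat dyadic_model e p"
    "\<forall>\<^sub>F n in sequentially. sat std_model (std_env e n) q \<longleftrightarrow> sat dyadic_model e q"
    by auto
  then show ?case by eventually_elim simp
next
  case (Con p q)
  then have "\<forall>\<^sub>F n in sequentially. sat std_model (std_env e n) p \<longleftrightarrow> sat dyadic_model e p"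
    "\<forall>\<^sub>F n in sequentially. sat std_model (std_env e n) q \<longleftrightarrow> sat dyadic_model e q"
    by auto
  then show ?case by eventually_elim simp
next
  case (Dis p q)
  then have "\<forall>\<^sub>F n in sequentially. sat std_model (std_env e n) p \<longleftrightarrow> sat dyadic_model e p"
    "\<forall>\<^sub>F n in sequentially. sat std_model (std_env e n) q \<longleftrightarrow> sat dyadic_model e q"
    by auto
  then show ?case by eventually_elim simp
qed simp_all

lemma Th_univ_dyadic_model:
  assumes "p \<in> Th_univ std_model"
  shows "true_in dyadic_model p"
proof -
  obtain n q where q: "quantifier_free q" "p = (Forall ^^ n) q"
    using assms by (auto simp: Th_univ_def universal_def)
  then have "true_in std_model q"
    using assms by (simp add: Th_univ_def true_in_Foralls)
  \<comment> \<open>The threshold depends on \<open>e\<close>, but a single suitable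
    \<open>n\<close> for each \<open>e\<close> is enough.\<close>
  moreover have "\<exists>n. sat std_model (std_env e n) q \<longleftrightarrow> sat dyadic_model e q" for e
    using eventually_sat_iff[OF q(1)] by (auto simp: eventually_sequentially)
  ultimately have "true_in dyadic_model q"
    by (simp add: true_in_def)
  then show ?thesis
    by (simp add: q(2) true_in_Foralls)
qed

theorem corollary12:
  "\<not> (PA_smu \<union> Th_univ std_model \<turnstile> pa17) \<and> \<not> (PA_smu \<turnstile> pa17)"
proof -
  \<comment> \<open>Arguing for all subsets settles both conjuncts at once.\<close>
  have "\<not> (\<Gamma> \<turnstile> pa17)" if "\<Gamma> \<subseteq> PA_smu \<union> Th_univ std_model" for \<Gamma>
  proof
    assume "\<Gamma> \<turnstile> pa17"
    then have "sat dyadic_model e pa17" for e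
      using that PA_smu_dyadic_model Th_univ_dyadic_model
      by (elim soundness) (auto simp: true_in_def)
    then show False
      using pa17_fails by blast
  qed
  then show ?thesis by blast
qed

end
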